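(* Every tight graph of type $4_n$ has at most $9$ zigzags.
   Context: A graph of type $4_n$ is (the skeleton of) a simple convex polyhedron with $n$ vertices, i.e. a $3$-connected $3$-valent finite simple plane graph, all of whose faces are $4$-gons or $6$-gons; it has exactly six $4$-gons. A zigzag is a circuit of edges obtained by alternately taking the left and the right neighbouring edge at successive vertices (so any two, but no three, consecutive edges lie on a common face); zigzags are considered up to direction and starting point. Each edge is covered exactly twice by zigzags (possibly twice by the same one). A railroad is a circuit of hexagonal faces (possibly self-intersecting) such that each hexagon is adjacent to its two neighbours in the circuit on opposite edges. A graph is tight if it has no railroad. *)

theory Defs
  imports
    "Graph_Theory.Digraph_Component"
    "HOL-Combinatorics.Orbits"
begin

text \<open>
  Plane graphs are encoded as combinatorial maps on the sphere. A simple graph is a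
  \<^locale>\<open>pair_graph\<close>; each edge is a pair of mutually reverse darts \<open>(u, v)\<close>,
  \<open>(v, u)\<close>. The rotation \<open>rot\<close> sends a dart to the next dart, counterclockwise, with
  the same tail.
\<close>

text \<open>
  \<open>face_step\<close> follows a face boundary: the face to the right of a dart \<open>d\<close> is
  identified with the orbit of \<open>d\<close>, and its length is the size of that orbit.
\<close>

definition face_step :: "('a \<times> 'a \<Rightarrow> 'a \<times> 'a) \<Rightarrow> 'a \<times> 'a \<Rightarrow> 'a \<times> 'a" where
  "face_step rot = rot \<circ> prod.swap"

definition face_of_dart :: "('a \<times> 'a \<Rightarrow> 'a \<times> 'a) \<Rightarrow> 'a \<times> 'a \<Rightarrow> ('a \<times> 'a) set" where
  "face_of_dart rot d = orbit (face_step rot) d"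

definition faces :: "'a pair_pre_digraph \<Rightarrow> ('a \<times> 'a \<Rightarrow> 'a \<times> 'a) \<Rightarrow> ('a \<times> 'a) set set" where
  "faces G rot = face_of_dart rot ` parcs G"

text \<open>
  The sphere is singled out by connectedness and Euler's formula; every edge gives two
  darts, hence the factor \<open>2\<close>.
\<close>

locale connected_plane_graph = pair_graph G for G :: "'a pair_pre_digraph" +
  fixes rot :: "'a \<times> 'a \<Rightarrow> 'a \<times> 'a"
  assumes rot_permutes: "rot permutes parcs G"
    and rot_cyclic: "\<And>v. \<lbrakk>v \<in> pverts G; out_arcs G v \<noteq> {}\<rbrakk> \<Longrightarrow> cyclic_on rot (out_arcs G v)"
    and connected: "connected G"
    and euler: "2 * int (card (pverts G)) - int (card (parcs G)) + 2 * int (card (faces G rot)) = 4"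

definition three_connected :: "'a pair_pre_digraph \<Rightarrow> bool" where
  "three_connected G \<longleftrightarrow> 3 < card (pverts G) \<and>
     (\<forall>S \<subseteq> pverts G. card S < 3 \<longrightarrow> connected (with_proj G \<restriction> (pverts G - S)))"

text \<open>
  By Euler's formula, such a graph has exactly six faces of length 4, so this is not
  required separately.
\<close>

definition type_4_graph :: "nat \<Rightarrow> 'a pair_pre_digraph \<Rightarrow> ('a \<times> 'a \<Rightarrow> 'a \<times> 'a) \<Rightarrow> bool" where
  "type_4_graph n G rot \<longleftrightarrow>
     connected_plane_graph G rot \<and>
     three_connected G \<and>
     card (pverts G) = n \<and>
     (\<forall>v \<in> pverts G. out_degree G v = 3) \<and>
     (\<forall>F \<in> faces G rot. card F = 4 \<or> card F = 6)"

text \<open>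
  A state \<open>(d, left)\<close> of a walk along a zigzag consists of the dart being traversed and
  of the direction of the turn to be made at its head. At the head of \<open>d\<close>, in a 3-valent
  graph, the left neighbouring edge precedes the reverse of \<open>d\<close> in the rotation, and the
  right one follows it.
\<close>

definition zigzag_step ::
    "('a \<times> 'a \<Rightarrow> 'a \<times> 'a) \<Rightarrow> ('a \<times> 'a) \<times> bool \<Rightarrow> ('a \<times> 'a) \<times> bool" where
  "zigzag_step rot = (\<lambda>(d, left). ((if left then inv rot else rot) (prod.swap d), \<not> left))"

text \<open>
  An orbit of \<^term>\<open>zigzag_step rot\<close> is a directed zigzag without a distinguished starting
  point. Traversing it backwards turns a state \<open>(d, left)\<close> into \<open>(prod.swap d, left)\<close>:
  if \<open>d\<close> is followed by \<open>e\<close> after a left turn, then \<open>prod.swap e\<close> is followed by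
  \<open>prod.swap d\<close> after a right turn, and the turns alternate. The union of the two orbits
  is therefore a zigzag up to direction and starting point.
\<close>

definition zigzag_of ::
    "('a \<times> 'a \<Rightarrow> 'a \<times> 'a) \<Rightarrow> ('a \<times> 'a) \<times> bool \<Rightarrow> (('a \<times> 'a) \<times> bool) set" where
  "zigzag_of rot = (\<lambda>(d, left).
     orbit (zigzag_step rot) (d, left) \<union> orbit (zigzag_step rot) (prod.swap d, left))"

definition zigzags ::
    "'a pair_pre_digraph \<Rightarrow> ('a \<times> 'a \<Rightarrow> 'a \<times> 'a) \<Rightarrow> (('a \<times> 'a) \<times> bool) set set" where
  "zigzags G rot = zigzag_of rot ` (parcs G \<times> UNIV)"

text \<open>
  The hexagons of a railroad are the faces of the darts \<open>ds ! i\<close>, where \<open>ds ! i\<close> lies on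
  the edge through which the hexagon is entered. It is left through the opposite edge,
  that of \<open>(face_step rot ^^ 3) (ds ! i)\<close>, and the reverse of that dart belongs to the
  adjacent face.
\<close>

definition railroad ::
    "'a pair_pre_digraph \<Rightarrow> ('a \<times> 'a \<Rightarrow> 'a \<times> 'a) \<Rightarrow> ('a \<times> 'a) list \<Rightarrow> bool" where
  "railroad G rot ds \<longleftrightarrow> ds \<noteq> [] \<and>
     (\<forall>i < length ds.
        ds ! i \<in> parcs G \<and>
        card (face_of_dart rot (ds ! i)) = 6 \<and>
        ds ! (Suc i mod length ds) = prod.swap ((face_step rot ^^ 3) (ds ! i)))"

definition tight :: "'a pair_pre_digraph \<Rightarrow> ('a \<times> 'a \<Rightarrow> 'a \<times> 'a) \<Rightarrow> bool" where
  "tight G rot \<longleftrightarrow> (\<nexists>ds. railroad G rot ds)"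

end

theory Submission
  imports Defs
begin

text \<open>
  At every second vertex a zigzag cuts a corner of the face on a given side of it, and the faces
  met in this way form a strip. As long as they are hexagons, the strip crosses them through
  opposite edges, so in a tight graph every strip meets a 4-gon. The six 4-gons have 24 corners,
  and the \<open>2 k\<close> sides of the \<open>k\<close> zigzags share them out, each corner going to exactly one
  side. If a corner \<open>c\<close> of a 4-gon is the only one of its side, then the chain of hexagons
  leaving the 4-gon through one of the two edges not in \<open>c\<close> returns through the other one. Hence
  the edges of the 4-gon not in the next corner are not joined to each other, and at most half
  of the 24 corners are alone on their side. Counting these with weight 2 and the others with
  weight 1, every side has weight at least 2 and the total is at most 36, so \<open>4 k \<le> 36\<close>.
\<close>

section \<open>Orbits of injective maps on finite sets\<close>

lemma finite_inj_self_in_orbit: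
  assumes "inj f" "finite A" "\<And>x. x \<in> A \<Longrightarrow> f x \<in> A" "x \<in> A"
  shows "x \<in> orbit f x"
proof -
  have "(f ^^ n) x \<in> A" for n
    by (induction n) (use assms in auto)
  then have "finite {y. \<exists>n. y = (f ^^ n) x}"
    using assms(2) by (auto intro: finite_subset)
  then obtain n where "n > 0" "(f ^^ n) x = x"
    using funpow_inj_finite[OF assms(1)] by blast
  then show ?thesis
    unfolding orbit_altdef by force
qed

lemma orbit_subset_invariant:
  assumes "\<And>x. x \<in> A \<Longrightarrow> f x \<in> A" "x \<in> A"
  shows "orbit f x \<subseteq> A"
proof
  fix y assume "y \<in> orbit f x"
  then show "y \<in> A" by induction (use assms in auto)
qed

lemma orbit_eq_of_mem:
  assumes "x \<in> orbit f x" "y \<in> orbit f x"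
  shows "orbit f y = orbit f x"
  by (rule orbit_cyclic_eq3[OF cyclic_on_singleI]) (use assms in auto)

lemma orbit_card_period:
  assumes "x \<in> orbit f x"
  shows "(f ^^ card (orbit f x)) x = x"
    and "inj_on (\<lambda>n. (f ^^ n) x) {0..<card (orbit f x)}"
proof -
  \<comment> \<open>\<open>funpow_dist1 f x x\<close> is the least positive return time; the
    iterates below it list the orbit without repetition.\<close>
  have "card (orbit f x) = funpow_dist1 f x x"
    by (subst orbit_conv_funpow_dist1[OF assms])
      (simp add: card_image inj_on_funpow_dist1[OF assms] del: funpow.simps)
  then show "(f ^^ card (orbit f x)) x = x"
    and "inj_on (\<lambda>n. (f ^^ n) x) {0..<card (orbit f x)}"
    using funpow_dist1_prop[OF assms] inj_on_funpow_dist1[OF assms] by simp_all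
qed

section \<open>Strips and zigzags as permutations of darts\<close>

text \<open>The successor rule of \<open>railroad\<close>, taken for faces of any length: the face
  of \<open>d\<close> is entered across \<open>d\<close> and left across the third edge after
  it.\<close>

definition strip_step :: "('a \<times> 'a \<Rightarrow> 'a \<times> 'a) \<Rightarrow> 'a \<times> 'a \<Rightarrow> 'a \<times> 'a" where
  "strip_step rot d = prod.swap ((face_step rot ^^ 3) d)"

locale cubic_map =
  fixes D :: "('a \<times> 'a) set" and rot :: "'a \<times> 'a \<Rightarrow> 'a \<times> 'a"
  assumes finite_darts: "finite D"
    and swap_dart: "d \<in> D \<Longrightarrow> prod.swap d \<in> D"
    and swap_neq: "d \<in> D \<Longrightarrow> prod.swap d \<noteq> d"
    and rot_permutes: "rot permutes D"
    and rot_cubed: "d \<in> D \<Longrightarrow> rot (rot (rot d)) = d"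
begin

abbreviation "\<phi> \<equiv> face_step rot"
abbreviation "\<tau> \<equiv> strip_step rot"

definition \<sigma> :: "'a \<times> 'a \<Rightarrow> 'a \<times> 'a" where
  "\<sigma> d = inv rot (prod.swap (rot (prod.swap d)))"

lemma rot_inv: "rot (inv rot d) = d" "inv rot (rot d) = d"
  using permutes_inverses[OF rot_permutes] by auto

lemma rot_dart: "d \<in> D \<Longrightarrow> rot d \<in> D"
  using permutes_in_image[OF rot_permutes] by simp

lemma inv_rot_dart: "d \<in> D \<Longrightarrow> inv rot d \<in> D"
  using permutes_in_image[OF permutes_inv[OF rot_permutes]] by simp

lemma inv_rot_eq: "d \<in> D \<Longrightarrow> inv rot d = rot (rot d)"
  by (metis rot_cubed rot_inv(2))

lemma face_step_apply: "\<phi> d = rot (prod.swap d)"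
  by (simp add: face_step_def)

lemma strip_step_apply: "\<tau> d = prod.swap (\<phi> (\<phi> (\<phi> d)))"
  by (simp add: strip_step_def numeral_3_eq_3)

lemma face_step_dart: "d \<in> D \<Longrightarrow> \<phi> d \<in> D"
  by (simp add: face_step_apply rot_dart swap_dart)

lemma strip_step_dart: "d \<in> D \<Longrightarrow> \<tau> d \<in> D"
  by (simp add: strip_step_apply face_step_dart swap_dart)

lemma inj_face_step: "inj \<phi>"
  unfolding face_step_def
  by (intro inj_compose permutes_inj[OF rot_permutes]) (rule inj_swap)

lemma inj_strip_step: "inj \<tau>"
proof (rule injI)
  fix x y assume "\<tau> x = \<tau> y"
  then have "\<phi> (\<phi> (\<phi> x)) = \<phi> (\<phi> (\<phi> y))"
    by (metis strip_step_apply swap_swap)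
  then show "x = y"
    by (simp add: inj_eq[OF inj_face_step])
qed

lemma inj_zigzag_step: "inj (zigzag_step rot)"
proof (rule injI)
  fix s t assume eq: "zigzag_step rot s = zigzag_step rot t"
  obtain d l e k where st: "s = (d, l)" "t = (e, k)"
    by (metis surj_pair)
  have "l = k"
    using eq by (simp add: zigzag_step_def st)
  moreover have "prod.swap d = prod.swap e"
    using eq inj_eq[OF permutes_inj[OF rot_permutes]]
      inj_eq[OF permutes_inj[OF permutes_inv[OF rot_permutes]]]
    by (simp add: zigzag_step_def st split: if_splits)
  then have "d = e"
    by (metis swap_swap)
  ultimately show "s = t"
    by (simp add: st)
qed

lemma zigzag_step_dart: "s \<in> D \<times> UNIV \<Longrightarrow> zigzag_step rot s \<in> D \<times> UNIV"
  by (cases s) (simp add: zigzag_step_def rot_dart inv_rot_dart swap_dart)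

lemma self_in_orbits:
  shows self_in_face: "d \<in> D \<Longrightarrow> d \<in> orbit \<phi> d"
    and self_in_strip: "d \<in> D \<Longrightarrow> d \<in> orbit \<tau> d"
    and self_in_zigzag: "s \<in> D \<times> UNIV \<Longrightarrow> s \<in> orbit (zigzag_step rot) s"
  using finite_inj_self_in_orbit[OF inj_face_step finite_darts face_step_dart]
    finite_inj_self_in_orbit[OF inj_strip_step finite_darts strip_step_dart]
    finite_inj_self_in_orbit[OF inj_zigzag_step _ zigzag_step_dart] finite_darts
  by auto

lemma strip_orbit_subset: "d \<in> D \<Longrightarrow> orbit \<tau> d \<subseteq> D"
  by (rule orbit_subset_invariant[OF strip_step_dart])

lemma strip_funpow_dart: "d \<in> D \<Longrightarrow> (\<tau> ^^ k) d \<in> D"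
  by (induction k) (auto simp: strip_step_dart)

lemma zigzag_two_steps: "zigzag_step rot (zigzag_step rot (d, False)) = (\<sigma> d, False)"
  by (simp add: zigzag_step_def \<sigma>_def)

lemma \<sigma>_dart: "d \<in> D \<Longrightarrow> \<sigma> d \<in> D"
  by (simp add: \<sigma>_def rot_dart inv_rot_dart swap_dart)

text \<open>
  This conjugacy turns the sides of zigzags into strips of faces crossed through opposite
  edges; in a 4-gon, \<^const>\<open>strip_step\<close> turns to a neighbouring edge instead.
\<close>

lemma \<sigma>_face_step: "d \<in> D \<Longrightarrow> \<sigma> (\<phi> d) = \<phi> (\<tau> d)"
  by (simp add: \<sigma>_def strip_step_apply face_step_apply inv_rot_eq rot_dart swap_dart)

lemma \<sigma>_funpow_face_step: "d \<in> D \<Longrightarrow> (\<sigma> ^^ k) (\<phi> d) = \<phi> ((\<tau> ^^ k) d)"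
  by (induction k) (auto simp: \<sigma>_face_step strip_funpow_dart)

section \<open>Reversal and the two sides of a zigzag\<close>

text \<open>Reversing the walk undoes it: swap conjugates \<sigma> to its inverse.\<close>

lemma \<sigma>_swap_\<sigma>: "\<sigma> (prod.swap (\<sigma> d)) = prod.swap d"
  by (simp add: \<sigma>_def rot_inv)

lemma inj_\<sigma>: "inj \<sigma>"
proof (rule injI)
  fix x y assume "\<sigma> x = \<sigma> y"
  then have "prod.swap x = prod.swap y"
    using \<sigma>_swap_\<sigma>[of x] \<sigma>_swap_\<sigma>[of y] by simp
  then show "x = y"
    by (metis swap_swap)
qed

lemma \<sigma>_funpow_swap: "(\<sigma> ^^ k) (prod.swap ((\<sigma> ^^ k) d)) = prod.swap d"
proof (induction k)
  case (Suc k)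
  have "(\<sigma> ^^ Suc k) (prod.swap ((\<sigma> ^^ Suc k) d))
      = (\<sigma> ^^ k) (\<sigma> (prod.swap (\<sigma> ((\<sigma> ^^ k) d))))"
    by (simp add: funpow_swap1)
  then show ?case
    using Suc by (simp add: \<sigma>_swap_\<sigma>)
qed simp

text \<open>
  A zigzag equal to its own reversal would be a cycle reflected onto itself; the midpoint
  of the reflection would be a dart fixed by swap.
\<close>

lemma \<sigma>_funpow_neq_swap:
  assumes "d \<in> D"
  shows "(\<sigma> ^^ k) d \<noteq> prod.swap d"
proof
  assume eq: "(\<sigma> ^^ k) d = prod.swap d"
  define j where "j = k div 2"
  define e where "e = (\<sigma> ^^ j) d"
  have inj: "inj (\<sigma> ^^ j)"
    by (rule inj_fn[OF inj_\<sigma>])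
  have e: "e \<in> D"
    unfolding e_def by (induction j) (auto simp: assms \<sigma>_dart)
  have swap_e: "(\<sigma> ^^ j) (prod.swap e) = prod.swap d"
    unfolding e_def by (rule \<sigma>_funpow_swap)
  show False
  proof (cases "even k")
    case True
    then have "k = j + j"
      unfolding j_def by presburger
    then have "(\<sigma> ^^ j) e = prod.swap d"
      using eq by (simp add: e_def funpow_add)
    with swap_e have "prod.swap e = e"
      using injD[OF inj] by simp
    then show False
      using swap_neq[OF e] by simp
  next
    case False
    then have "k = j + Suc j"
      unfolding j_def by presburger
    then have "(\<sigma> ^^ j) (\<sigma> e) = prod.swap d"
      using eq by (simp add: e_def funpow_add funpow_swap1)
    with swap_e have "prod.swap e = \<sigma> e"
      using injD[OF inj] by simp
    \<comment> \<open>For odd \<open>k\<close> the midpoint falls inside a double step, on the dart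
      \<open>rot (prod.swap e)\<close> traversed between \<open>e\<close> and
      \<open>\<sigma> e\<close>.\<close>
    then have "rot (prod.swap e) = rot (inv rot (prod.swap (rot (prod.swap e))))"
      unfolding \<sigma>_def by (rule arg_cong)
    then have "rot (prod.swap e) = prod.swap (rot (prod.swap e))"
      by (simp only: rot_inv)
    then show False
      using swap_neq[OF rot_dart[OF swap_dart[OF e]]] by simp
  qed
qed

text \<open>A step forward along one directed orbit is a step backward along the reversed one, so
  neither half of the union changes.\<close>

lemma zigzag_of_step:
  assumes "s \<in> D \<times> UNIV"
  shows "zigzag_of rot (zigzag_step rot s) = zigzag_of rot s"
proof -
  obtain d l where s: "s = (d, l)" by fastforce
  obtain e where e: "zigzag_step rot s = (e, \<not> l)"
    by (simp add: s zigzag_step_def)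
  have "e \<in> D"
    using zigzag_step_dart[OF assms] e by simp
  then have "(prod.swap e, \<not> l) \<in> D \<times> UNIV"
    by (simp add: swap_dart)
  note self_in_orbit_step[OF self_in_zigzag[OF this]]
  moreover have "zigzag_step rot (prod.swap e, \<not> l) = (prod.swap d, l)"
    using e by (cases l) (auto simp: s zigzag_step_def rot_inv)
  ultimately have
    "orbit (zigzag_step rot) (prod.swap d, l) = orbit (zigzag_step rot) (prod.swap e, \<not> l)"
    by simp
  moreover have "orbit (zigzag_step rot) (e, \<not> l) = orbit (zigzag_step rot) (d, l)"
    using self_in_orbit_step[OF self_in_zigzag[OF assms]] e by (simp add: s)
  ultimately show ?thesis
    by (simp add: e[unfolded s] s zigzag_of_def)
qed

text \<open>The dart \<open>d\<close> stands for the corner between \<open>\<phi> d\<close> and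
  \<open>\<phi> (\<phi> d)\<close>, which this zigzag cuts by a right turn. The shift by \<phi> is
  that of the conjugacy and makes the value constant along strips.\<close>

definition zigzag_at :: "'a \<times> 'a \<Rightarrow> (('a \<times> 'a) \<times> bool) set" where
  "zigzag_at d = zigzag_of rot (\<phi> d, False)"

lemma zigzag_at_strip_step: "d \<in> D \<Longrightarrow> zigzag_at (\<tau> d) = zigzag_at d"
  using zigzag_two_steps[of "\<phi> d"] zigzag_of_step[of "(\<phi> d, False)"]
    zigzag_of_step[OF zigzag_step_dart, of "(\<phi> d, False)"]
  by (simp add: zigzag_at_def \<sigma>_face_step face_step_dart)

lemma zigzag_at_strip_orbit:
  assumes "d \<in> D" "e \<in> orbit \<tau> d"
  shows "zigzag_at e = zigzag_at d"
  using assms(2)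
proof induction
  case base
  show ?case by (rule zigzag_at_strip_step[OF assms(1)])
next
  case (step e)
  then have "e \<in> D"
    using strip_orbit_subset[OF assms(1)] by blast
  then show ?case
    using step by (simp add: zigzag_at_strip_step)
qed

lemma ex_face_step: "d \<in> D \<Longrightarrow> \<exists>c\<in>D. \<phi> c = d"
  by (rule bexI[of _ "prod.swap (inv rot d)"])
    (auto simp: face_step_apply rot_inv inv_rot_dart swap_dart)

lemma zigzag_of_eq_zigzag_at:
  assumes "d \<in> D"
  shows "\<exists>c\<in>D. zigzag_of rot (d, l) = zigzag_at c"
proof -
  obtain e where e: "e \<in> D" "zigzag_of rot (d, l) = zigzag_of rot (e, False)"
  proof (cases l)
    \<comment> \<open>One step turns a pending left turn into a pending right turn on the same
      zigzag.\<close>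
    case True
    then have "zigzag_step rot (d, l) = (inv rot (prod.swap d), False)"
      by (simp add: zigzag_step_def)
    then show ?thesis
      using that[of "inv rot (prod.swap d)"] zigzag_of_step[of "(d, l)"] assms
      by (simp add: inv_rot_dart swap_dart)
  qed (use assms in auto)
  then show ?thesis
    using ex_face_step[OF e(1)] unfolding zigzag_at_def by metis
qed

text \<open>The reversed walk cuts the corners on the other side. If the two strips met, the
  conjugacy would make a power of \<sigma> reverse a dart.\<close>

lemma ex_opposite_side:
  assumes "c \<in> D"
  shows "\<exists>c'\<in>D. zigzag_at c' = zigzag_at c \<and> orbit \<tau> c' \<inter> orbit \<tau> c = {}"
proof -
  obtain c' where c': "c' \<in> D" "\<phi> c' = prod.swap (\<phi> c)"
    using ex_face_step swap_dart face_step_dart assms by metis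
  have "c' \<notin> orbit \<tau> c"
  proof
    assume "c' \<in> orbit \<tau> c"
    then obtain k where "c' = (\<tau> ^^ k) c"
      unfolding orbit_altdef by auto
    then have "(\<sigma> ^^ k) (\<phi> c) = prod.swap (\<phi> c)"
      using c' \<sigma>_funpow_face_step[OF assms] by simp
    then show False
      using \<sigma>_funpow_neq_swap face_step_dart assms by blast
  qed
  then have "orbit \<tau> c' \<inter> orbit \<tau> c = {}"
    using orbit_eq_of_mem self_in_strip assms c'(1) by (metis disjoint_iff)
  moreover have "zigzag_at c' = zigzag_at c"
    by (auto simp: zigzag_at_def zigzag_of_def c')
  ultimately show ?thesis
    using c'(1) by blast
qed

section \<open>Counting darts by the length of their face\<close>

lemma card_darts_of_faces:
  "card {d \<in> D. card (face_of_dart rot d) = k}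
    = k * card {F \<in> face_of_dart rot ` D. card F = k}"
proof -
  let ?C = "{F \<in> face_of_dart rot ` D. card F = k}"
  have self: "d \<in> face_of_dart rot d" if "d \<in> D" for d
    using self_in_face[OF that] by (simp add: face_of_dart_def)
  have sub: "face_of_dart rot d \<subseteq> D" if "d \<in> D" for d
    unfolding face_of_dart_def by (rule orbit_subset_invariant[OF face_step_dart that])
  have eq: "face_of_dart rot e = face_of_dart rot d" if "d \<in> D" "e \<in> face_of_dart rot d" for d e
    using that orbit_eq_of_mem[OF self_in_face] by (simp add: face_of_dart_def)
  have Union: "\<Union> ?C = {d \<in> D. card (face_of_dart rot d) = k}"
  proof (intro equalityI subsetI)
    fix e assume "e \<in> \<Union> ?C"
    then obtain d where d: "d \<in> D" "e \<in> face_of_dart rot d" "card (face_of_dart rot d) = k"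
      by blast
    then show "e \<in> {d \<in> D. card (face_of_dart rot d) = k}"
      using sub[OF d(1)] eq[OF d(1,2)] by auto
  next
    fix d assume "d \<in> {d \<in> D. card (face_of_dart rot d) = k}"
    then show "d \<in> \<Union> ?C"
      using self[of d] by auto
  qed
  have "k * card ?C = card (\<Union> ?C)"
  proof (rule card_partition)
    show "finite ?C"
      using finite_darts by simp
    show "finite (\<Union> ?C)"
      unfolding Union using finite_darts by simp
    show "F \<inter> F' = {}" if F: "F \<in> ?C" "F' \<in> ?C" "F \<noteq> F'" for F F'
    proof (rule ccontr)
      assume "F \<inter> F' \<noteq> {}"
      then obtain e where e: "e \<in> F" "e \<in> F'"
        by blast
      obtain d d' where "d \<in> D" "F = face_of_dart rot d" "d' \<in> D" "F' = face_of_dart rot d'"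
        using F(1,2) by blast
      then show False
        using eq[of d e] eq[of d' e] e F(3) by simp
    qed
  qed simp
  then show ?thesis
    by (simp only: Union)
qed

end

section \<open>Corners of 4-gons and their weights in a tight map\<close>

locale tight_4_6_map = cubic_map +
  assumes face_card: "d \<in> D \<Longrightarrow> card (face_of_dart rot d) = 4 \<or> card (face_of_dart rot d) = 6"
    and strip_not_hexagonal:
      "d \<in> D \<Longrightarrow> \<exists>e \<in> orbit (strip_step rot) d. card (face_of_dart rot e) \<noteq> 6"
begin

definition square_darts :: "('a \<times> 'a) set" where
  "square_darts = {d \<in> D. card (face_of_dart rot d) = 4}"

definition lonely_darts :: "('a \<times> 'a) set" where
  "lonely_darts = {d \<in> square_darts. orbit \<tau> d \<inter> square_darts = {d}}"

definition weight :: "'a \<times> 'a \<Rightarrow> nat" where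
  "weight d = (if d \<in> lonely_darts then 2 else 1)"

lemma square_dart: "d \<in> square_darts \<Longrightarrow> d \<in> D"
  by (simp add: square_darts_def)

lemma finite_square_darts: "finite square_darts"
  using finite_darts by (simp add: square_darts_def)

lemma square_face:
  assumes "d \<in> square_darts"
  shows "\<phi> (\<phi> (\<phi> (\<phi> d))) = d" "\<phi> (\<phi> (\<phi> d)) \<noteq> \<phi> d" "\<phi> d \<in> square_darts"
proof -
  have d: "d \<in> D" "card (orbit \<phi> d) = 4"
    using assms by (auto simp: square_darts_def face_of_dart_def)
  have "(\<phi> ^^ 4) d = d" and inj: "inj_on (\<lambda>n. (\<phi> ^^ n) d) {0..<4}"
    using orbit_card_period[OF self_in_face[OF d(1)]] d(2) by auto
  then show "\<phi> (\<phi> (\<phi> (\<phi> d))) = d"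
    by (simp add: eval_nat_numeral)
  have "(\<phi> ^^ 3) d \<noteq> (\<phi> ^^ 1) d"
    using inj_onD[OF inj, of 3 1] by auto
  then show "\<phi> (\<phi> (\<phi> d)) \<noteq> \<phi> d"
    by (simp add: eval_nat_numeral)
  show "\<phi> d \<in> square_darts"
    using d self_in_orbit_step[OF self_in_face[OF d(1)]]
    by (simp add: square_darts_def face_of_dart_def face_step_dart)
qed

lemma hexagon_face:
  assumes "d \<in> D" "d \<notin> square_darts"
  shows "\<phi> (\<phi> (\<phi> (\<phi> (\<phi> (\<phi> d))))) = d"
proof -
  have "card (orbit \<phi> d) = 6"
    using assms face_card[OF assms(1)] by (auto simp: square_darts_def face_of_dart_def)
  then show ?thesis
    using orbit_card_period(1)[OF self_in_face[OF assms(1)]] by (simp add: eval_nat_numeral)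
qed

text \<open>
  A strip from a 4-gon back to the same dart \<open>c\<close> leaves through the edge of
  \<open>(\<phi> ^^ 3) c\<close> and enters through that of \<open>c\<close>. Run backwards, it leaves through the
  edge of \<open>c\<close>, which is the exit of the strip of \<open>\<phi> c\<close>, and enters at \<open>(\<phi> ^^ 3) c\<close>.
\<close>

lemma face_step_lonely:
  assumes "c \<in> lonely_darts"
  shows "\<phi> c \<in> square_darts - lonely_darts"
proof -
  have c: "c \<in> square_darts" "orbit \<tau> c \<inter> square_darts = {c}"
    using assms by (auto simp: lonely_darts_def)
  note D = square_dart[OF c(1)]
  have "\<exists>m. 0 < m \<and> (\<tau> ^^ m) c \<in> square_darts"
    using self_in_strip[OF D] c(1) unfolding orbit_altdef by force
  then obtain m where m: "0 < m" "(\<tau> ^^ m) c \<in> square_darts"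
      and least: "\<And>i. 0 < i \<Longrightarrow> i < m \<Longrightarrow> (\<tau> ^^ i) c \<notin> square_darts"
    unfolding exists_least_iff[of "\<lambda>m. 0 < m \<and> (\<tau> ^^ m) c \<in> square_darts"] by blast
  have "(\<tau> ^^ m) c \<in> orbit \<tau> c"
    using m(1) unfolding orbit_altdef by blast
  \<comment> \<open>The first return to any 4-gon is a return to \<open>c\<close>, because
    \<open>c\<close> is alone on its strip.\<close>
  then have recurs: "(\<tau> ^^ m) c = c"
    using m(2) c(2) by blast
  \<comment> \<open>The start is \<open>\<phi> c\<close>, whose third successor in the 4-gon is
    \<open>c\<close>. By minimality of \<open>m\<close> all faces in between are hexagons, where
    crossing to the opposite edge is reversible.\<close>
  have reversed: "(\<tau> ^^ Suc j) (\<phi> c) = prod.swap ((\<tau> ^^ (m - j)) c)" if "j < m" for j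
    using that
  proof (induction j)
    case 0
    then show ?case
      by (simp add: recurs strip_step_apply[of "\<phi> c"] square_face(1)[OF c(1)])
  next
    case (Suc j)
    define x where "x = (\<tau> ^^ (m - Suc j)) c"
    have x: "x \<in> D" "x \<notin> square_darts"
      unfolding x_def using Suc.prems least[of "m - Suc j"] by (simp_all add: strip_funpow_dart D)
    have "m - j = Suc (m - Suc j)"
      using Suc.prems by simp
    then have "(\<tau> ^^ (m - j)) c = \<tau> x"
      unfolding x_def by simp
    then have "(\<tau> ^^ Suc (Suc j)) (\<phi> c) = \<tau> (prod.swap (\<tau> x))"
      using Suc by simp
    also have "\<dots> = prod.swap x"
      by (simp add: strip_step_apply hexagon_face[OF x])
    finally show ?case
      unfolding x_def .
  qed
  have "(\<tau> ^^ m) (\<phi> c) = \<phi> (\<phi> (\<phi> c))"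
    using reversed[of "m - 1"] m(1) by (simp add: strip_step_apply)
  then have "\<phi> (\<phi> (\<phi> c)) \<in> orbit \<tau> (\<phi> c)"
    using m(1) unfolding orbit_altdef by force
  moreover have "\<phi> (\<phi> (\<phi> c)) \<in> square_darts"
    by (intro square_face(3) c(1))
  ultimately have "\<phi> c \<notin> lonely_darts"
    using square_face(2)[OF c(1)] by (auto simp: lonely_darts_def)
  then show ?thesis
    using square_face(3)[OF c(1)] by blast
qed

text \<open>\<phi> injects the lonely darts into the other darts of 4-gons, so at most half are
  lonely; each adds one to the cardinality.\<close>

lemma sum_weight_square_darts: "2 * sum weight square_darts \<le> 3 * card square_darts"
proof -
  have L: "lonely_darts \<subseteq> square_darts"
    by (auto simp: lonely_darts_def)
  have "card lonely_darts = card (\<phi> ` lonely_darts)"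
    by (rule card_image[OF inj_on_subset[OF inj_face_step], symmetric]) simp
  also have "\<dots> \<le> card (square_darts - lonely_darts)"
    by (rule card_mono) (use face_step_lonely finite_square_darts in auto)
  finally have "2 * card lonely_darts \<le> card square_darts"
    using card_Diff_subset[OF finite_subset[OF L finite_square_darts] L]
      card_mono[OF finite_square_darts L] by linarith
  moreover have "sum weight square_darts
      = (\<Sum>d\<in>square_darts. 1 + (if d \<in> lonely_darts then 1 else 0))"
    by (rule sum.cong) (auto simp: weight_def)
  then have "sum weight square_darts = card square_darts + card lonely_darts"
    using L finite_square_darts
    by (simp only: sum.distrib card_eq_sum) (simp add: sum.If_cases Int_absorb1)
  ultimately show ?thesis by linarith
qed

text \<open>Tightness provides one 4-gon dart on the strip. Either it is lonely and counts twice, or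
  a second one contributes.\<close>

lemma sum_weight_strip_orbit:
  assumes "c \<in> D"
  shows "2 \<le> sum weight (orbit \<tau> c \<inter> square_darts)"
proof -
  have fin: "finite (orbit \<tau> c \<inter> square_darts)"
    using finite_square_darts by simp
  obtain e where e: "e \<in> orbit \<tau> c" "card (face_of_dart rot e) \<noteq> 6"
    using strip_not_hexagonal[OF assms] by blast
  then have "e \<in> D"
    using strip_orbit_subset[OF assms] by blast
  with e(2) have e_square: "e \<in> square_darts"
    using face_card[of e] by (simp add: square_darts_def)
  show ?thesis
  proof (cases "orbit \<tau> c \<inter> square_darts = {e}")
    case True
    then have "e \<in> lonely_darts"
      using orbit_eq_of_mem[OF self_in_strip[OF assms] e(1)] e_square by (simp add: lonely_darts_def)
    then show ?thesis
      by (simp add: True weight_def)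
  next
    case False
    then obtain e' where e': "e' \<in> orbit \<tau> c \<inter> square_darts" "e' \<noteq> e"
      using e(1) e_square by blast
    have "sum weight {e, e'} \<le> sum weight (orbit \<tau> c \<inter> square_darts)"
      by (rule sum_mono2[OF fin]) (use e(1) e_square e'(1) in auto)
    then show ?thesis
      using e'(2) by (auto simp: weight_def split: if_splits)
  qed
qed

text \<open>The two sides of a zigzag are disjoint strips of weight at least 2 each. Grouping the
  4-gon darts by \<open>zigzag_at\<close> counts every dart once, so the number of zigzags times 4
  is at most the total weight.\<close>

lemma card_zigzags_le:
  "8 * card (zigzag_of rot ` (D \<times> UNIV)) \<le> 3 * card square_darts"
proof -
  let ?Z = "zigzag_of rot ` (D \<times> UNIV)"
  have fin: "finite ?Z"
    using finite_darts by simp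
  have "4 \<le> sum weight {d \<in> square_darts. zigzag_at d = Z}" if "Z \<in> ?Z" for Z
  proof -
    obtain d l where "d \<in> D" "Z = zigzag_of rot (d, l)"
      using \<open>Z \<in> ?Z\<close> by blast
    then obtain c where c: "c \<in> D" "Z = zigzag_at c"
      using zigzag_of_eq_zigzag_at by blast
    obtain c' where c': "c' \<in> D" "zigzag_at c' = zigzag_at c" "orbit \<tau> c' \<inter> orbit \<tau> c = {}"
      using ex_opposite_side[OF c(1)] by blast
    have "4 \<le> sum weight (orbit \<tau> c \<inter> square_darts) + sum weight (orbit \<tau> c' \<inter> square_darts)"
      using sum_weight_strip_orbit[OF c(1)] sum_weight_strip_orbit[OF c'(1)] by simp
    also have "\<dots> = sum weight (orbit \<tau> c \<inter> square_darts \<union> orbit \<tau> c' \<inter> square_darts)"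
      by (rule sum.union_disjoint[symmetric]) (use finite_square_darts c'(3) in auto)
    also have "\<dots> \<le> sum weight {d \<in> square_darts. zigzag_at d = Z}"
    proof (rule sum_mono2)
      show "orbit \<tau> c \<inter> square_darts \<union> orbit \<tau> c' \<inter> square_darts
          \<subseteq> {d \<in> square_darts. zigzag_at d = Z}"
        using zigzag_at_strip_orbit[OF c(1)] zigzag_at_strip_orbit[OF c'(1)] c(2) c'(2) by blast
    qed (use finite_square_darts in auto)
    finally show ?thesis .
  qed
  then have "4 * card ?Z \<le> (\<Sum>Z\<in>?Z. sum weight {d \<in> square_darts. zigzag_at d = Z})"
    using sum_bounded_below[of ?Z "4 :: nat"] by (simp add: mult.commute)
  also have "\<dots> = sum weight square_darts"
    by (rule sum.group[OF finite_square_darts fin])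
      (auto simp: zigzag_at_def intro!: imageI face_step_dart dest!: square_dart)
  finally show ?thesis
    using sum_weight_square_darts by linarith
qed

end

section \<open>From plane graphs to cubic maps, and the number of 4-gons\<close>

lemma (in connected_plane_graph) cubic_map_parcs:
  assumes "\<And>v. v \<in> pverts G \<Longrightarrow> out_degree G v = 3"
  shows "cubic_map (parcs G) rot"
proof
  show "finite (parcs G)"
    by (rule pair_finite_arcs)
  show "prod.swap d \<in> parcs G" if "d \<in> parcs G" for d
    using that arcs_symmetric by (cases d) simp
  show "prod.swap d \<noteq> d" if "d \<in> parcs G" for d
    using pair_no_loops[OF that] by (cases d) auto
  show "rot permutes parcs G"
    by (rule rot_permutes)
  show "rot (rot (rot d)) = d" if "d \<in> parcs G" for d
  proof -
    have v: "fst d \<in> pverts G" and d: "d \<in> out_arcs G (fst d)"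
      using that arc_fst_in_verts by (auto simp: out_arcs_def)
    \<comment> \<open>The rotation is a single cycle on the three darts leaving a vertex, hence of
      order 3.\<close>
    have "cyclic_on rot (out_arcs G (fst d))"
      using rot_cyclic[OF v] d by blast
    from orbit_cyclic_eq3[OF this d] have orbit: "orbit rot d = out_arcs G (fst d)" .
    then have "d \<in> orbit rot d" and "card (orbit rot d) = 3"
      using d assms[OF v] by (auto simp: out_degree_def)
    then show ?thesis
      using orbit_card_period(1)[of d rot] by (simp add: eval_nat_numeral)
  qed
qed

lemma (in pair_fin_digraph) card_parcs_regular:
  assumes "\<And>v. v \<in> pverts G \<Longrightarrow> out_degree G v = k"
  shows "card (parcs G) = k * card (pverts G)"
proof -
  have "parcs G = (\<Union>v\<in>pverts G. out_arcs G v)"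
    by (auto simp: out_arcs_def intro: in_arcsD1)
  moreover have "card (\<Union>v\<in>pverts G. out_arcs G v) = (\<Sum>v\<in>pverts G. card (out_arcs G v))"
    by (rule card_UN_disjoint)
      (auto simp: pair_finite_verts out_arcs_def pair_finite_arcs)
  ultimately show ?thesis
    using assms by (simp add: out_degree_def)
qed

text \<open>Let \<open>A\<close> be the number of darts, \<open>V\<close> of vertices,
  \<open>p\<close> of 4-gons and \<open>q\<close> of hexagons. From \<open>A = 3 V\<close>,
  \<open>A = 4 p + 6 q\<close> and Euler's formula, \<open>q\<close> cancels and
  \<open>2 p = 12\<close>.\<close>

lemma card_square_darts_eq:
  assumes "type_4_graph n G rot"
  shows "card {d \<in> parcs G. card (face_of_dart rot d) = 4} = 24"
proof -
  interpret connected_plane_graph G rot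
    using assms by (simp add: type_4_graph_def)
  have deg: "\<And>v. v \<in> pverts G \<Longrightarrow> out_degree G v = 3"
    and face: "\<And>F. F \<in> faces G rot \<Longrightarrow> card F = 4 \<or> card F = 6"
    using assms by (auto simp: type_4_graph_def)
  interpret cubic_map "parcs G" rot
    by (rule cubic_map_parcs[OF deg])
  let ?D = "\<lambda>k. {d \<in> parcs G. card (face_of_dart rot d) = k}"
  let ?F = "\<lambda>k. {F \<in> faces G rot. card F = k}"
  have D: "card (?D k) = k * card (?F k)" for k
    unfolding faces_def by (rule card_darts_of_faces)
  have "parcs G = ?D 4 \<union> ?D 6"
    using face by (auto simp: faces_def)
  then have "card (parcs G) = card (?D 4 \<union> ?D 6)"
    by simp
  also have "\<dots> = card (?D 4) + card (?D 6)"
    by (rule card_Un_disjoint) (auto simp: pair_finite_arcs)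
  finally have darts: "card (parcs G) = card (?D 4) + card (?D 6)" .
  have fin: "finite (faces G rot)"
    by (simp add: faces_def pair_finite_arcs)
  have "faces G rot = ?F 4 \<union> ?F 6"
    using face by auto
  then have "card (faces G rot) = card (?F 4 \<union> ?F 6)"
    by simp
  also have "\<dots> = card (?F 4) + card (?F 6)"
    by (rule card_Un_disjoint) (auto simp: fin)
  finally have "card (faces G rot) = card (?F 4) + card (?F 6)" .
  with darts D[of 4] D[of 6] card_parcs_regular[OF deg] euler show ?thesis
    by linarith
qed

text \<open>A strip is periodic; if all its faces were hexagons, one period of it would be a
  railroad.\<close>

lemma tight_strip_not_hexagonal:
  assumes "cubic_map (parcs G) rot" "tight G rot" "d \<in> parcs G"
  shows "\<exists>e \<in> orbit (strip_step rot) d. card (face_of_dart rot e) \<noteq> 6"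
proof (rule ccontr)
  assume "\<not> ?thesis"
  then have hex: "\<And>e. e \<in> orbit (strip_step rot) d \<Longrightarrow> card (face_of_dart rot e) = 6"
    by blast
  interpret cubic_map "parcs G" rot by fact
  have self: "d \<in> orbit \<tau> d"
    by (rule self_in_strip[OF assms(3)])
  obtain m where m: "0 < m" "(\<tau> ^^ m) d = d"
    using self unfolding orbit_altdef by force
  define ds where "ds = map (\<lambda>i. (\<tau> ^^ i) d) [0..<m]"
  have "railroad G rot ds"
    unfolding railroad_def
  proof (intro conjI allI impI)
    show "ds \<noteq> []"
      using m(1) by (simp add: ds_def)
    fix i assume i: "i < length ds"
    show "ds ! i \<in> parcs G"
      using i by (simp add: ds_def strip_funpow_dart assms(3))
    show "card (face_of_dart rot (ds ! i)) = 6"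
      using i by (simp add: ds_def hex funpow_in_orbit[OF self])
    \<comment> \<open>At the last index the successor wraps around to \<open>d\<close>, which closes
      the circuit.\<close>
    have "(\<tau> ^^ (Suc i mod m)) d = (\<tau> ^^ Suc i) d"
      by (rule funpow_mod_eq[OF m(2)])
    then show "ds ! (Suc i mod length ds) = prod.swap ((face_step rot ^^ 3) (ds ! i))"
      using i m(1) by (simp add: ds_def strip_step_def)
  qed
  then show False
    using assms(2) by (auto simp: tight_def)
qed

theorem theorem6p3:
  fixes n :: nat
    and G :: "'a pair_pre_digraph"
    and rot :: "'a \<times> 'a \<Rightarrow> 'a \<times> 'a"
  assumes "type_4_graph n G rot"
    and "tight G rot"
  shows "card (zigzags G rot) \<le> 9"
proof -
  interpret connected_plane_graph G rot
    using assms(1) by (simp add: type_4_graph_def)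
  have cubic: "cubic_map (parcs G) rot"
    by (rule cubic_map_parcs) (use assms(1) in \<open>simp add: type_4_graph_def\<close>)
  interpret tight_4_6_map "parcs G" rot
  proof (intro tight_4_6_map.intro tight_4_6_map_axioms.intro)
    show "card (face_of_dart rot d) = 4 \<or> card (face_of_dart rot d) = 6" if "d \<in> parcs G" for d
      using that assms(1) by (auto simp: type_4_graph_def faces_def)
  qed (use cubic tight_strip_not_hexagonal[OF cubic assms(2)] in auto)
  \<comment> \<open>With 24 darts on 4-gons, eight times the number of zigzags is at most
    72.\<close>
  show ?thesis
    using card_zigzags_le card_square_darts_eq[OF assms(1)]
    by (simp add: zigzags_def square_darts_def)
qed

end
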